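(* A graph $G$ has an exact-distance square root if and only if $G$ is equal, as a labelled graph, to $\overline{G}^{[\sharp 2]}$, the exact-distance square of the complement $\overline{G}$ of $G$.
   Context: All graphs are finite and simple. For a graph $H=(V,E)$, its exact-distance square $H^{[\sharp 2]}$ is the graph with vertex set $V$ in which distinct vertices $x,y$ are adjacent if and only if their distance in $H$ is exactly $2$. A graph $H$ is an exact-distance square root of $G$ if $V(H)=V(G)$ and $H^{[\sharp 2]}=G$ (as labelled graphs). $\overline{G}$ denotes the complement of $G$ (same vertex set, distinct vertices adjacent iff they are non-adjacent in $G$). *)

theory Defs
  imports "Graph_Theory.Pair_Digraph" "Graph_Theory.Shortest_Path"
begin

text \<open>
  Finite simple graphs are rendered by the locale \<^locale>\<open>pair_graph\<close>: finite, loop-free,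
  symmetric digraphs whose arcs are pairs of vertices, so that an edge between \<open>x\<close> and \<open>y\<close>
  corresponds to the two arcs \<open>(x, y)\<close> and \<open>(y, x)\<close>. The graph without vertices is included.
  Equality of labelled graphs is equality of these records.
\<close>

text \<open>
  The distance is the least number of arcs of a walk from \<open>x\<close> to \<open>y\<close>. Between vertices in
  different components it is \<open>\<infinity>\<close>. It is meaningful only for well-formed \<open>H\<close>,
  since \<open>\<mu>\<close> is specified inside the locale \<^locale>\<open>wf_digraph\<close>.
\<close>
definition graph_dist :: "'a pair_pre_digraph \<Rightarrow> 'a \<Rightarrow> 'a \<Rightarrow> ereal" where
  "graph_dist H x y = wf_digraph.\<mu> (with_proj H) (\<lambda>_. 1) x y"

definition exact_distance_square :: "'a pair_pre_digraph \<Rightarrow> 'a pair_pre_digraph" where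
  "exact_distance_square H =
    \<lparr> pverts = pverts H,
      parcs = {(x, y). x \<in> pverts H \<and> y \<in> pverts H \<and> x \<noteq> y \<and> graph_dist H x y = 2} \<rparr>"

definition exact_distance_square_root ::
    "'a pair_pre_digraph \<Rightarrow> 'a pair_pre_digraph \<Rightarrow> bool" where
  "exact_distance_square_root H G \<longleftrightarrow>
    pair_graph H \<and> pverts H = pverts G \<and> exact_distance_square H = G"

definition graph_complement :: "'a pair_pre_digraph \<Rightarrow> 'a pair_pre_digraph" where
  "graph_complement G =
    \<lparr> pverts = pverts G,
      parcs = {(x, y). x \<in> pverts G \<and> y \<in> pverts G \<and> x \<noteq> y \<and> (x, y) \<notin> parcs G} \<rparr>"

lemma pair_graph_complement:
  assumes "pair_graph G"
  shows "pair_graph (graph_complement G)"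
proof -
  interpret pair_graph G by fact
  have fin: "finite (parcs (graph_complement G))"
    by (rule finite_subset[of _ "pverts G \<times> pverts G"])
      (auto simp: graph_complement_def pair_finite_verts)
  have sym: "sym (parcs G)"
    using pair_sym_arcs by (simp add: symmetric_def)
  show ?thesis
    using fin pair_finite_verts sym
    by unfold_locales (auto simp: graph_complement_def symmetric_def sym_def)
qed

end

theory Submission
  imports Defs
begin

text \<open>
  Two vertices are at distance 2 in \<open>H\<close> iff they are distinct, non-adjacent and have a common
  neighbour in \<open>H\<close>. If \<open>H\<close> is a root of \<open>G\<close>, no edge of \<open>H\<close> is an edge of \<open>G\<close>, so \<open>H\<close> is a
  subgraph of the complement of \<open>G\<close>. Hence the common neighbours in \<open>H\<close> of the ends of an edge
  of \<open>G\<close> remain common neighbours in the complement, while vertices at distance 2 in the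
  complement are non-adjacent there, that is, adjacent in \<open>G\<close>.
\<close>

lemma (in wf_digraph) awalk_cost_one: "awalk_cost (\<lambda>_. 1) p = real (length p)"
  by (induct p) auto

text \<open>A walk of length 0 forces \<open>x = y\<close>, one of length 1 is the arc
  \<open>(x, y)\<close>, and one of length 2 passes through some \<open>z\<close>. So the right-hand
  side says that the shortest walk has length exactly 2.\<close>

lemma (in pair_wf_digraph) graph_dist_eq_2_iff:
  "graph_dist G x y = 2 \<longleftrightarrow>
    x \<noteq> y \<and> (x, y) \<notin> parcs G \<and> (\<exists>z. (x, z) \<in> parcs G \<and> (z, y) \<in> parcs G)"
  (is "_ \<longleftrightarrow> ?R")
proof -
  have dist: "graph_dist G x y = (INF p\<in>{p. awalk x p y}. ereal (real (length p)))"
    by (simp add: graph_dist_def \<mu>_def awalk_cost_one)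
  have walk_length_2: "\<exists>z. (x, z) \<in> parcs G \<and> (z, y) \<in> parcs G"
    if "awalk x p y" "length p = 2" for p
    using that by (auto simp: awalk_def numeral_2_eq_2 length_Suc_conv)
  show ?thesis
  proof
    assume d: "graph_dist G x y = 2"
    have ge: "2 \<le> length p" if "awalk x p y" for p
    proof -
      have "graph_dist G x y \<le> ereal (real (length p))"
        unfolding dist using that by (intro INF_lower) simp
      then have "ereal 2 \<le> ereal (real (length p))"
        using d by simp
      then show ?thesis by simp
    qed
    \<comment> \<open>A strict upper bound on the infimum yields an actual walk below it; with
      \<open>ge\<close>, a bound of 3 leaves only length 2.\<close>
    have "graph_dist G x y < ereal 3"
      using d by simp
    then obtain p where p: "awalk x p y" "length p < 3"
      unfolding dist by (auto simp: INF_less_iff)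
    have len: "length p = 2"
      using ge[OF p(1)] p(2) by simp
    \<comment> \<open>Otherwise \<open>[]\<close> would be a walk of length 0; \<open>p\<close>
      ensures that \<open>x\<close> is a vertex, as the empty walk requires.\<close>
    have "x \<noteq> y"
      using ge[of "[]"] p(1) by (auto simp: awalk_Nil_iff)
    moreover have "(x, y) \<notin> parcs G"
      using ge[of "[(x, y)]"] arc_implies_awalk[of "(x, y)"] by auto
    ultimately show ?R
      using walk_length_2[OF p(1) len] by blast
  next
    assume R: ?R
    then obtain z where z: "(x, z) \<in> parcs G" "(z, y) \<in> parcs G" by blast
    show "graph_dist G x y = 2"
      unfolding dist
    proof (rule antisym)
      have "awalk x [(x, z), (z, y)] y"
        using z by (auto simp: awalk_def dest: in_arcsD1)
      then show "(INF p\<in>{p. awalk x p y}. ereal (real (length p))) \<le> 2"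
        by (intro INF_lower2[of "[(x, z), (z, y)]"]) auto
      have "2 \<le> length p" if "awalk x p y" for p
      proof (rule ccontr)
        assume "\<not> 2 \<le> length p"
        \<comment> \<open>\<open>remdups_adj.cases\<close> serves as a case split into empty,
          singleton and longer lists.\<close>
        then have "p = [] \<or> (\<exists>e. p = [e])"
          by (cases p rule: remdups_adj.cases) auto
        then show False
          using R that by (auto simp: awalk_def)
      qed
      then have "ereal 2 \<le> ereal (real (length p))" if "awalk x p y" for p
        using that by fastforce
      then show "2 \<le> (INF p\<in>{p. awalk x p y}. ereal (real (length p)))"
        by (intro INF_greatest) auto
    qed
  qed
qed

text \<open>The vertex conditions of the definition disappear because \<open>x\<close> and
  \<open>y\<close> are ends of arcs at \<open>z\<close>.\<close>

lemma parcs_exact_distance_square_iff: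
  assumes "pair_wf_digraph H"
  shows "(x, y) \<in> parcs (exact_distance_square H) \<longleftrightarrow>
    x \<noteq> y \<and> (x, y) \<notin> parcs H \<and> (\<exists>z. (x, z) \<in> parcs H \<and> (z, y) \<in> parcs H)"
proof -
  interpret pair_wf_digraph H by fact
  show ?thesis
    unfolding exact_distance_square_def graph_dist_eq_2_iff
    by (auto dest: in_arcsD1 in_arcsD2)
qed

lemma pverts_exact_distance_square [simp]: "pverts (exact_distance_square H) = pverts H"
  by (simp add: exact_distance_square_def)

lemma pverts_graph_complement [simp]: "pverts (graph_complement G) = pverts G"
  by (simp add: graph_complement_def)

lemma parcs_graph_complement_iff:
  "(x, y) \<in> parcs (graph_complement G) \<longleftrightarrow>
    x \<in> pverts G \<and> y \<in> pverts G \<and> x \<noteq> y \<and> (x, y) \<notin> parcs G"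
  by (simp add: graph_complement_def)

lemma exact_distance_square_root_subgraph_complement:
  assumes "exact_distance_square_root H G"
  shows "parcs H \<subseteq> parcs (graph_complement G)"
proof -
  interpret H: pair_graph H
    using assms by (simp add: exact_distance_square_root_def)
  have verts: "pverts H = pverts G" and square: "exact_distance_square H = G"
    using assms by (simp_all add: exact_distance_square_root_def)
  show ?thesis
    using parcs_exact_distance_square_iff[OF H.pair_wf_digraph_axioms] H.pair_no_loops
      H.in_arcsD1 H.in_arcsD2
    unfolding square verts by (fastforce simp: parcs_graph_complement_iff)
qed

theorem theorem1:
  fixes G :: "'a pair_pre_digraph"
  assumes "pair_graph G"
  shows "(\<exists>H. exact_distance_square_root H G) \<longleftrightarrow>
    G = exact_distance_square (graph_complement G)"
proof
  interpret G: pair_graph G by fact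
  interpret C: pair_graph "graph_complement G"
    using assms by (rule pair_graph_complement)
  note C_iff = parcs_exact_distance_square_iff[OF C.pair_wf_digraph_axioms]
  assume "\<exists>H. exact_distance_square_root H G"
  then obtain H where root: "exact_distance_square_root H G" ..
  then interpret H: pair_graph H
    by (simp add: exact_distance_square_root_def)
  have square: "exact_distance_square H = G"
    using root by (simp add: exact_distance_square_root_def)
  note H_iff = parcs_exact_distance_square_iff[OF H.pair_wf_digraph_axioms, unfolded square]
  have "(x, y) \<in> parcs G \<longleftrightarrow> (x, y) \<in> parcs (exact_distance_square (graph_complement G))"
    for x y
  proof
    assume xy: "(x, y) \<in> parcs G"
    then obtain z where "(x, z) \<in> parcs H" "(z, y) \<in> parcs H" "x \<noteq> y"
      by (auto simp: H_iff)
    \<comment> \<open>Only the pair \<open>(x, y)\<close> is unfolded in the complement; the arcs at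
      \<open>z\<close> stay folded, so that the inclusion of \<open>parcs H\<close> applies to
      them.\<close>
    then show "(x, y) \<in> parcs (exact_distance_square (graph_complement G))"
      using exact_distance_square_root_subgraph_complement[OF root] xy
      by (auto simp: C_iff parcs_graph_complement_iff[of x y])
  next
    assume "(x, y) \<in> parcs (exact_distance_square (graph_complement G))"
    \<comment> \<open>The arcs at the common neighbour show that \<open>x\<close> and
      \<open>y\<close> are vertices of \<open>G\<close>.\<close>
    then show "(x, y) \<in> parcs G"
      by (auto simp: C_iff parcs_graph_complement_iff)
  qed
  then have "parcs G = parcs (exact_distance_square (graph_complement G))"
    by auto
  then show "G = exact_distance_square (graph_complement G)"
    by (intro pair_pre_digraph.equality) auto
next
  assume "G = exact_distance_square (graph_complement G)"
  \<comment> \<open>The complement itself is the witness.\<close>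
  then have "exact_distance_square_root (graph_complement G) G"
    using pair_graph_complement[OF assms] by (simp add: exact_distance_square_root_def)
  then show "\<exists>H. exact_distance_square_root H G" ..
qed

end
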